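(* $c(2,1)\leq 3$, $c(3,-1)>3$, and $c(2,2)>3$.
   Context: A finite digraph $D=(V,A)$ is covered by $k$ cuts if there are $U_1,\dots,U_k\subseteq V$ such that every arc $uv\in A$ has some $a$ with $u\in U_a$, $v\notin U_a$; equivalently, there is a labeling $C:V\to\mathcal{P}(\{1,\dots,k\})$ with $C(u)\not\subseteq C(v)$ for every arc $uv$. For integers $\Delta^-,\Delta^+\geq -1$, $\mathcal{D}(\Delta^-,\Delta^+)$ is the class of all finite acyclic digraphs in which every vertex has indegree at most $\Delta^-$ or outdegree at most $\Delta^+$ (so $\mathcal{D}(\Delta^-,-1)$ is the class of acyclic digraphs of maximum indegree at most $\Delta^-$), and $c(\Delta^-,\Delta^+)$ is the smallest $k$ such that every digraph in $\mathcal{D}(\Delta^-,\Delta^+)$ is covered by $k$ cuts. *)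

theory Defs
  imports "Graph_Theory.Graph_Theory" "HOL-Library.Extended_Nat"
begin

definition covered_by_cuts :: "nat \<Rightarrow> 'a pair_pre_digraph \<Rightarrow> bool" where
  "covered_by_cuts k D \<longleftrightarrow>
     (\<exists>U :: nat \<Rightarrow> 'a set. (\<forall>i\<in>{1..k}. U i \<subseteq> pverts D) \<and>
        (\<forall>(u, v)\<in>parcs D. \<exists>i\<in>{1..k}. u \<in> U i \<and> v \<notin> U i))"

text \<open>The parameters are integers because the value \<open>-1\<close> is allowed: a degree is never at
  most \<open>-1\<close>, so such a parameter switches off the corresponding alternative.\<close>

definition acyclic_digraph_class :: "int \<Rightarrow> int \<Rightarrow> 'a pair_pre_digraph set" where
  "acyclic_digraph_class dm dp =
     {D. pair_fin_digraph D \<and> acyclic (parcs D) \<and>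
         (\<forall>v\<in>pverts D. int (in_degree (with_proj D) v) \<le> dm \<or>
                        int (out_degree (with_proj D) v) \<le> dp)}"

text \<open>The definition of \<open>cut_number\<close> cannot quantify over vertex types. Vertices are taken from
  \<open>nat\<close>, which loses nothing since every finite digraph is isomorphic to one on natural numbers;
  see \<open>covered_by_cuts_of_nat\<close> below. The infimum over \<open>enat\<close> is the least such \<open>k\<close>, and would be
  \<open>\<infinity>\<close> if there were none.\<close>

definition cut_number :: "int \<Rightarrow> int \<Rightarrow> enat" where
  "cut_number dm dp =
     Inf {enat k | k. \<forall>D :: nat pair_pre_digraph.
            D \<in> acyclic_digraph_class dm dp \<longrightarrow> covered_by_cuts k D}"

lemma covered_by_cuts_of_nat:
  fixes D :: "'a pair_pre_digraph"
  assumes all: "\<And>E :: nat pair_pre_digraph. E \<in> acyclic_digraph_class dm dp \<Longrightarrow> covered_by_cuts k E"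
    and D: "D \<in> acyclic_digraph_class dm dp"
  shows "covered_by_cuts k D"
proof -
  interpret pair_fin_digraph D
    using D by (simp add: acyclic_digraph_class_def)
  obtain f :: "'a \<Rightarrow> nat" where f: "inj_on f (pverts D)"
    using finite_imp_inj_to_nat_seg[OF pair_finite_verts] by blast
  define E where "E = \<lparr>pverts = f ` pverts D, parcs = map_prod f f ` parcs D\<rparr>"
  have inj: "inj_on (map_prod f f) (parcs D)"
    by (rule inj_on_subset[OF map_prod_inj_on[OF f f]]) (auto dest: in_arcsD1 in_arcsD2)
  have deg: "in_degree (with_proj E) (f v) = in_degree (with_proj D) v"
    "out_degree (with_proj E) (f v) = out_degree (with_proj D) v" if v: "v \<in> pverts D" for v
  proof -
    have eq: "f a = f v \<longleftrightarrow> a = v" "f b = f v \<longleftrightarrow> b = v" if "(a, b) \<in> parcs D" for a b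
      using in_arcsD1[OF that] in_arcsD2[OF that] inj_on_eq_iff[OF f] v by blast+
    have "in_arcs (with_proj E) (f v) = map_prod f f ` in_arcs (with_proj D) v"
      by (force simp: in_arcs_def E_def eq)
    moreover have "inj_on (map_prod f f) (in_arcs (with_proj D) v)"
      by (rule inj_on_subset[OF inj]) (auto simp: in_arcs_def)
    ultimately show "in_degree (with_proj E) (f v) = in_degree (with_proj D) v"
      by (simp add: in_degree_def card_image)
    have "out_arcs (with_proj E) (f v) = map_prod f f ` out_arcs (with_proj D) v"
      by (force simp: out_arcs_def E_def eq)
    moreover have "inj_on (map_prod f f) (out_arcs (with_proj D) v)"
      by (rule inj_on_subset[OF inj]) (auto simp: out_arcs_def)
    ultimately show "out_degree (with_proj E) (f v) = out_degree (with_proj D) v"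
      by (simp add: out_degree_def card_image)
  qed
  define h where "h = inv_into (pverts D) f"
  have hf: "h (f v) = v" if "v \<in> pverts D" for v
    using f that by (simp add: h_def)
  have arc: "(h x, h y) \<in> parcs D" if xy: "(x, y) \<in> parcs E" for x y
  proof -
    obtain a b where "(a, b) \<in> parcs D" "x = f a" "y = f b"
      using xy by (auto simp: E_def)
    then show ?thesis using hf in_arcsD1 in_arcsD2 by metis
  qed
  have pull: "(h x, h y) \<in> (parcs D)\<^sup>+" if "(x, y) \<in> (parcs E)\<^sup>+" for x y
    using that by induction (auto intro: arc trancl_into_trancl)
  have "acyclic (parcs E)"
    using D pull by (auto simp: acyclic_digraph_class_def acyclic_def)
  moreover have "pair_fin_digraph E"
    by unfold_locales (auto simp: E_def pair_finite_verts pair_finite_arcs dest: in_arcsD1 in_arcsD2)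
  ultimately have "E \<in> acyclic_digraph_class dm dp"
    using D deg by (auto simp: acyclic_digraph_class_def E_def)
  from all[OF this] obtain U where
    U: "\<And>u v. (u, v) \<in> parcs E \<Longrightarrow> \<exists>i\<in>{1..k}. u \<in> U i \<and> v \<notin> U i"
    unfolding covered_by_cuts_def by fast
  have "\<exists>i\<in>{1..k}. u \<in> {w \<in> pverts D. f w \<in> U i} \<and> v \<notin> {w \<in> pverts D. f w \<in> U i}"
    if "(u, v) \<in> parcs D" for u v
    using U[of "f u" "f v"] that by (force simp: E_def dest: in_arcsD1)
  then show ?thesis
    unfolding covered_by_cuts_def
    by (intro exI[of _ "\<lambda>i. {w \<in> pverts D. f w \<in> U i}"]) auto
qed

end

theory Submission
  imports Defs
begin

text \<open>For \<open>c(2,1) \<le> 3\<close>, let \<open>A\<close> be the set of vertices of indegree at most 2. Choose a colour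
  \<open>g v \<in> {1,2,3}\<close> for each vertex, first on \<open>A\<close> along the arcs so that the colouring is proper on
  \<open>A\<close>, then on the remaining vertices against the arcs: such a vertex has at most one
  out-neighbour, whose colour it repeats if that neighbour lies in \<open>A\<close> and avoids otherwise.
  The labels \<open>{1,2,3} - {g v}\<close> on \<open>A\<close> and \<open>{g v}\<close> elsewhere then work.

  For the lower bounds, consider the digraph of all trees of bounded height with at most \<open>k\<close>
  children per node, with an arc from each child to its parent. When every label is nonempty, two
  children per node already force either all singletons or all pairs to occur as labels, and all
  singletons as soon as one singleton occurs near the leaves. With three children, all pairs force
  a singleton, and all singletons force an empty label, which only a sink can carry; hence
  \<open>c(3,-1) > 3\<close>.

  For \<open>c(2,2) > 3\<close>, join all vertices of a binary tree digraph to a vertex \<open>U\<close>, which forces the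
  label of \<open>U\<close> to be a singleton \<open>{i}\<close>. Add arcs \<open>U \<rightarrow> V\<close>, \<open>U \<rightarrow> W\<close>, \<open>V \<rightarrow> W\<close>: the labels of \<open>V\<close>
  and \<open>W\<close> avoid \<open>i\<close> and the former is not contained in the latter, so \<open>W\<close> carries a singleton.
  Using \<open>W\<close> as the leaf of a second binary tree digraph produces all singletons, and these
  force an empty label on a non-sink \<open>Z\<close> that receives an arc from every vertex of it.\<close>

section \<open>Labelings, cut numbers and degrees\<close>

lemma covered_by_cuts_iff_labeling:
  "covered_by_cuts k D \<longleftrightarrow>
     (\<exists>C. (\<forall>v. C v \<subseteq> {1..k}) \<and> (\<forall>u v. (u, v) \<in> parcs D \<longrightarrow> \<not> C u \<subseteq> C v))"
  if "pair_wf_digraph D"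
proof
  assume "covered_by_cuts k D"
  then obtain U where U: "\<forall>(u, v)\<in>parcs D. \<exists>i\<in>{1..k}. u \<in> U i \<and> v \<notin> U i"
    unfolding covered_by_cuts_def by blast
  show "\<exists>C. (\<forall>v. C v \<subseteq> {1..k}) \<and> (\<forall>u v. (u, v) \<in> parcs D \<longrightarrow> \<not> C u \<subseteq> C v)"
    by (rule exI[of _ "\<lambda>v. {i\<in>{1..k}. v \<in> U i}"]) (use U in fast)
next
  interpret pair_wf_digraph D by (fact that)
  assume "\<exists>C. (\<forall>v. C v \<subseteq> {1..k}) \<and> (\<forall>u v. (u, v) \<in> parcs D \<longrightarrow> \<not> C u \<subseteq> C v)"
  then obtain C where C: "\<And>v. C v \<subseteq> {1..k}" "\<And>u v. (u, v) \<in> parcs D \<Longrightarrow> \<not> C u \<subseteq> C v"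
    by blast
  have "\<exists>i\<in>{1..k}. u \<in> {w \<in> pverts D. i \<in> C w} \<and> v \<notin> {w \<in> pverts D. i \<in> C w}"
    if "(u, v) \<in> parcs D" for u v
    using C(1)[of u] C(2)[OF that] in_arcsD1[OF that] by blast
  then show "covered_by_cuts k D"
    unfolding covered_by_cuts_def
    by (intro exI[of _ "\<lambda>i. {w \<in> pverts D. i \<in> C w}"]) auto
qed

lemma covered_by_cuts_mono:
  assumes "covered_by_cuts k D" "k \<le> l"
  shows "covered_by_cuts l D"
proof -
  obtain U where U: "\<forall>i\<in>{1..k}. U i \<subseteq> pverts D"
    "\<forall>(u, v)\<in>parcs D. \<exists>i\<in>{1..k}. u \<in> U i \<and> v \<notin> U i"
    using assms(1) unfolding covered_by_cuts_def by blast
  define W where "W i = (if i \<le> k then U i else {})" for i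
  have "\<exists>i\<in>{1..l}. u \<in> W i \<and> v \<notin> W i" if uv: "(u, v) \<in> parcs D" for u v
  proof -
    obtain i where "i \<in> {1..k}" "u \<in> U i" "v \<notin> U i"
      using U(2) uv by fast
    then show ?thesis using assms(2) by (intro bexI[of _ i]) (auto simp: W_def)
  qed
  moreover have "W i \<subseteq> pverts D" if "i \<in> {1..l}" for i
    using U(1) that by (simp add: W_def)
  ultimately show ?thesis
    unfolding covered_by_cuts_def by blast
qed

lemma cut_number_le:
  assumes "\<And>D :: nat pair_pre_digraph. D \<in> acyclic_digraph_class dm dp \<Longrightarrow> covered_by_cuts k D"
  shows "cut_number dm dp \<le> enat k"
  unfolding cut_number_def using assms by (intro Inf_lower) blast

text \<open>One bad digraph over any vertex type suffices: \<open>covered_by_cuts_of_nat\<close>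
  transfers to it every bound valid over \<open>nat\<close>, and by monotonicity such a bound
  exceeds \<open>k\<close>.\<close>

lemma cut_number_greater:
  fixes D :: "'a pair_pre_digraph"
  assumes D: "D \<in> acyclic_digraph_class dm dp" and nc: "\<not> covered_by_cuts k D"
  shows "cut_number dm dp > enat k"
proof -
  have "enat (Suc k) \<le> cut_number dm dp"
    unfolding cut_number_def
  proof (rule Inf_greatest)
    fix x
    assume "x \<in> {enat k | k. \<forall>D :: nat pair_pre_digraph.
            D \<in> acyclic_digraph_class dm dp \<longrightarrow> covered_by_cuts k D}"
    then obtain l where l: "x = enat l"
      "\<And>E :: nat pair_pre_digraph. E \<in> acyclic_digraph_class dm dp \<Longrightarrow> covered_by_cuts l E"
      by blast
    have "covered_by_cuts l D"
      using l(2) D by (rule covered_by_cuts_of_nat)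
    then have "\<not> l \<le> k"
      using nc covered_by_cuts_mono by blast
    then show "enat (Suc k) \<le> x"
      using l(1) by simp
  qed
  then show ?thesis
    by (rule less_le_trans[rotated]) simp
qed

lemma in_degree_eq_card:
  "in_degree (with_proj D) v = card {u. (u, v) \<in> parcs D}"
proof -
  have "in_arcs (with_proj D) v = (\<lambda>u. (u, v)) ` {u. (u, v) \<in> parcs D}"
    by (auto simp: in_arcs_def)
  then show ?thesis
    by (simp add: in_degree_def card_image inj_on_def)
qed

lemma out_degree_eq_card:
  "out_degree (with_proj D) v = card {w. (v, w) \<in> parcs D}"
proof -
  have "out_arcs (with_proj D) v = Pair v ` {w. (v, w) \<in> parcs D}"
    by (auto simp: out_arcs_def)
  then show ?thesis
    by (simp add: out_degree_def card_image inj_on_def)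
qed

lemma card_le_length:
  assumes "S \<subseteq> set xs"
  shows "card S \<le> length xs"
  using card_mono[OF finite_set assms] card_length[of xs] by linarith

section \<open>The upper bound by two greedy colourings\<close>

text \<open>Colouring by recursion along \<open>r\<close>, the predecessors of \<open>v\<close> use
  fewer than \<open>card K\<close> colours, so one is free for \<open>v\<close>.\<close>

lemma greedy_coloring:
  fixes r :: "'a rel" and K :: "'b set"
  assumes wf: "wf r" and fin: "finite r"
    and deg: "\<And>v. card {u. (u, v) \<in> r} < card K"
  shows "\<exists>f. \<forall>v. f v \<in> K \<and> (\<forall>u. (u, v) \<in> r \<longrightarrow> f u \<noteq> f v)"
proof (rule dependent_wf_choice[OF wf, of "\<lambda>f v c. c \<in> K \<and> (\<forall>u. (u, v) \<in> r \<longrightarrow> f u \<noteq> c)"])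
  fix v and f :: "'a \<Rightarrow> 'b"
  have "finite {u. (u, v) \<in> r}"
    by (rule finite_subset[OF _ finite_imageI[OF fin, of fst]]) force
  then have "card (f ` {u. (u, v) \<in> r}) < card K" "finite (f ` {u. (u, v) \<in> r})"
    using card_image_le deg le_less_trans by blast+
  then have "\<not> K \<subseteq> f ` {u. (u, v) \<in> r}"
    using card_mono leD by blast
  then show "\<exists>c. c \<in> K \<and> (\<forall>u. (u, v) \<in> r \<longrightarrow> f u \<noteq> c)"
    by blast
qed auto

lemma covered_by_three_cuts:
  assumes "D \<in> acyclic_digraph_class 2 1"
  shows "covered_by_cuts 3 D"
proof -
  interpret pair_fin_digraph D
    using assms by (simp add: acyclic_digraph_class_def)
  have acyc: "acyclic (parcs D)"
    using assms by (simp add: acyclic_digraph_class_def)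
  have fin: "finite (parcs D)" by (fact pair_finite_arcs)
  define K where "K = {1..3::nat}"
  define A where "A = {v. card {u. (u, v) \<in> parcs D} \<le> 2}"
  have B: "card {w. (v, w) \<in> parcs D} \<le> 1" if "v \<notin> A" for v
  proof (cases "v \<in> pverts D")
    case True
    then have "int (in_degree (with_proj D) v) \<le> 2 \<or> int (out_degree (with_proj D) v) \<le> 1"
      using assms by (simp add: acyclic_digraph_class_def)
    then show ?thesis using that by (simp add: in_degree_eq_card out_degree_eq_card A_def)
  next
    case False
    then have "{w. (v, w) \<in> parcs D} = {}" using in_arcsD1 by blast
    then show ?thesis by simp
  qed
  have uniq: "w = w'" if "v \<notin> A" "(v, w) \<in> parcs D" "(v, w') \<in> parcs D" for v w w'
  proof -
    have "finite {w. (v, w) \<in> parcs D}"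
      by (rule finite_subset[OF _ finite_imageI[OF fin, of snd]]) force
    then show ?thesis
      using B[OF that(1)] that(2,3) card_le_Suc0_iff_eq by (metis One_nat_def mem_Collect_eq)
  qed
  \<comment> \<open>Only arcs into \<open>A\<close> are kept, so every vertex has at most two
    predecessors under \<open>r\<close> and three colours suffice.\<close>
  define r where "r = {(u, v) \<in> parcs D. v \<in> A}"
  have "\<exists>f. \<forall>v. f v \<in> K \<and> (\<forall>u. (u, v) \<in> r \<longrightarrow> f u \<noteq> f v)"
  proof (rule greedy_coloring)
    have rs: "r \<subseteq> parcs D" by (auto simp: r_def)
    then show "wf r"
      using finite_acyclic_wf[OF fin acyc] wf_subset by blast
    show "finite r" using rs fin finite_subset by blast
    fix v
    have "{u. (u, v) \<in> r} = (if v \<in> A then {u. (u, v) \<in> parcs D} else {})"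
      by (auto simp: r_def)
    then show "card {u. (u, v) \<in> r} < card K"
      by (auto simp: A_def K_def)
  qed
  then obtain f where f: "\<And>v. f v \<in> K"
    "\<And>u v. (u, v) \<in> parcs D \<Longrightarrow> v \<in> A \<Longrightarrow> f u \<noteq> f v"
    by (auto simp: r_def)
  define P where "P = (\<lambda>g v c. c \<in> K \<and> (v \<in> A \<longrightarrow> c = f v) \<and>
    (v \<notin> A \<longrightarrow> (\<forall>w. (v, w) \<in> parcs D \<longrightarrow> (c = g w \<longleftrightarrow> w \<in> A))))"
  have "\<exists>g. \<forall>v. P g v (g v)"
  \<comment> \<open>The converse is well-founded as well, so a vertex is coloured after its
    out-neighbours. Outside \<open>A\<close> there is at most one of them, so its single condition
    can be met.\<close>
  proof (rule dependent_wf_choice[of "(parcs D)\<inverse>"])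
    show "wf ((parcs D)\<inverse>)"
      by (rule finite_acyclic_wf_converse[OF fin acyc])
    show "P g v c = P h v c" if "\<And>w. (w, v) \<in> (parcs D)\<inverse> \<Longrightarrow> g w = h w" for g h v c
      using that by (auto simp: P_def)
    fix v g
    assume IH: "\<And>w. (w, v) \<in> (parcs D)\<inverse> \<Longrightarrow> P g w (g w)"
    show "\<exists>c. P g v c"
    proof (cases "v \<in> A \<or> (\<forall>w. (v, w) \<notin> parcs D)")
      case True
      then show ?thesis using f(1) by (auto simp: P_def)
    next
      case False
      then obtain w where w: "v \<notin> A" "(v, w) \<in> parcs D" by blast
      have gw: "g w \<in> K" using IH w(2) by (auto simp: P_def)
      have "\<exists>c\<in>K. c = g w \<longleftrightarrow> w \<in> A"
      proof (cases "w \<in> A")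
        case False
        have "\<not> K \<subseteq> {g w}"
          using card_mono[of "{g w}" K] by (auto simp: K_def)
        then show ?thesis using False by blast
      qed (use gw in blast)
      then show ?thesis
        using uniq[OF w(1) w(2)] w(1) unfolding P_def by blast
    qed
  qed
  then obtain g where "\<And>v. P g v (g v)" by blast
  then have gK: "\<And>v. g v \<in> K" and gA: "\<And>v. v \<in> A \<Longrightarrow> g v = f v"
    and gB: "\<And>v w. v \<notin> A \<Longrightarrow> (v, w) \<in> parcs D \<Longrightarrow> g v = g w \<longleftrightarrow> w \<in> A"
    by (auto simp: P_def)
  define C where "C v = (if v \<in> A then K - {g v} else {g v})" for v
  \<comment> \<open>Within \<open>A\<close>, complements of distinct singletons are incomparable;
    outside \<open>A\<close>, the singletons differ; into \<open>A\<close> from outside, the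
    singleton is the colour removed at the head. From \<open>A\<close> outwards, a pair cannot lie
    in a singleton.\<close>
  have "\<not> C u \<subseteq> C v" if uv: "(u, v) \<in> parcs D" for u v
  proof (cases "u \<in> A \<and> v \<notin> A")
    case True
    have "\<not> K \<subseteq> {g u, g v}"
      using card_mono[of "{g u, g v}" K] card_insert_le_m1[of 2 "{g v}" "g u"] by (auto simp: K_def)
    then show ?thesis using True by (auto simp: C_def)
  next
    case False
    then show ?thesis
      using gK[of u] gK[of v] gA[of u] gA[of v] gB[OF _ uv] f(2)[OF uv]
      by (auto simp: C_def)
  qed
  moreover have "C v \<subseteq> {1..3}" for v
    using gK[of v] by (auto simp: C_def K_def)
  ultimately show ?thesis
    unfolding covered_by_cuts_iff_labeling[OF pair_wf_digraph_axioms] by blast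
qed

section \<open>Labels forced by joining two children\<close>

lemma card_3_obtain_others:
  assumes "card K = 3" "i \<in> K"
  obtains j k where "K = {i, j, k}" "i \<noteq> j" "i \<noteq> k" "j \<noteq> k"
proof -
  have "card (K - {i}) = 2" using assms by simp
  then obtain j k where jk: "K - {i} = {j, k}" "j \<noteq> k" by (auto simp: card_2_iff)
  then show ?thesis using assms(2) by (intro that[of j k]) blast+
qed

text \<open>Two distinct elements of \<open>c\<close> would already form one of the pairs
  \<open>K - {j}\<close>.\<close>

lemma singleton_if_no_pair:
  assumes "card K = 3" "c \<subseteq> K" "c \<noteq> {}" and no_pair: "\<And>j. j \<in> K \<Longrightarrow> \<not> K - {j} \<subseteq> c"
  shows "\<exists>i\<in>K. c = {i}"
proof -
  obtain i where i: "i \<in> c" "i \<in> K" using assms(2,3) by blast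
  obtain j k where K: "K = {i, j, k}"
    using card_3_obtain_others[OF assms(1) i(2)] .
  have "\<not> K - {j} \<subseteq> c" "\<not> K - {k} \<subseteq> c" using no_pair K by auto
  then have "j \<notin> c" "k \<notin> c" using i(1) K by auto
  then have "c = {i}" using i(1) assms(2) K by auto
  then show ?thesis using i(2) by blast
qed

text \<open>In the next two lemmas \<open>L t\<close> stands for the set of labels occurring on trees of height at
  most \<open>t\<close>, a single node having height 0.\<close>

lemma singletons_attained:
  assumes K: "card K = 3"
    and mono: "\<And>t. L t \<subseteq> L (Suc t)"
    and join: "\<And>s a b. s < n \<Longrightarrow> a \<in> L s \<Longrightarrow> b \<in> L s \<Longrightarrow>
      \<exists>c\<in>L (Suc s). c \<subseteq> K \<and> c \<noteq> {} \<and> \<not> a \<subseteq> c \<and> \<not> b \<subseteq> c"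
    and i: "i \<in> K" "{i} \<in> L t" and tn: "t + 3 \<le> n"
  shows "\<forall>j\<in>K. {j} \<in> L (t + 3)"
proof -
  have m: "x \<in> L t'" if "x \<in> L s" "s \<le> t'" for x s t'
    using lift_Suc_mono_le[of L, OF mono that(2)] that(1) by blast
  obtain j k where jk: "K = {i, j, k}" "i \<noteq> j" "i \<noteq> k" "j \<noteq> k"
    using card_3_obtain_others[OF K i(1)] .
  \<comment> \<open>Each new node gets a child labelled \<open>{i}\<close>, which confines its label
    to \<open>{j, k}\<close>. The previous node as second child makes \<open>d\<close> one of the
    two singletons and then \<open>e\<close> the other.\<close>
  obtain c where c: "c \<in> L (Suc t)" "c \<subseteq> K" "c \<noteq> {}" "i \<notin> c"
    using join[of t "{i}" "{i}"] i(2) tn by auto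
  then have cs: "c \<subseteq> {j, k}" using jk by auto
  obtain d where d: "d \<in> L (Suc (Suc t))" "d \<subseteq> K" "d \<noteq> {}" "i \<notin> d" "\<not> c \<subseteq> d"
    using join[of "Suc t" "{i}" c] m[OF i(2)] c(1) tn by auto
  have ds: "d \<subseteq> {j, k}" using d jk by auto
  have "\<not> {j, k} \<subseteq> d" using cs d(5) by blast
  then have dd: "d = {j} \<or> d = {k}" using ds d(3) by blast
  obtain e where e: "e \<in> L (Suc (Suc (Suc t)))" "e \<subseteq> K" "e \<noteq> {}" "i \<notin> e" "\<not> d \<subseteq> e"
    using join[of "Suc (Suc t)" "{i}" d] m[OF i(2)] d(1) tn by auto
  have es: "e \<subseteq> {j, k}" using e jk by auto
  have "(d = {j} \<and> e = {k}) \<or> (d = {k} \<and> e = {j})"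
    using dd es e(3,5) by blast
  then have "{i} \<in> L (t + 3)" "{j} \<in> L (t + 3)" "{k} \<in> L (t + 3)"
    using m[OF i(2), of "t + 3"] m[OF d(1), of "t + 3"] m[OF e(1), of "t + 3"] by auto
  then show ?thesis using jk by simp
qed

lemma singletons_or_pairs_attained:
  assumes K: "card K = 3"
    and mono: "\<And>t. L t \<subseteq> L (Suc t)"
    and join: "\<And>s a b. s < n \<Longrightarrow> a \<in> L s \<Longrightarrow> b \<in> L s \<Longrightarrow>
      \<exists>c\<in>L (Suc s). c \<subseteq> K \<and> c \<noteq> {} \<and> \<not> a \<subseteq> c \<and> \<not> b \<subseteq> c"
    and ne: "a \<in> L 0" "a \<subseteq> K" and n: "6 \<le> n"
  shows "(\<forall>j\<in>K. {j} \<in> L 6) \<or> (\<forall>j\<in>K. K - {j} \<in> L 3)"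
proof (cases "\<exists>i\<in>K. {i} \<in> L 3")
  case True
  then show ?thesis
    using singletons_attained[where L = L, OF K mono join, where t = 3] n by auto
next
  case False
  have m: "x \<in> L t'" if "x \<in> L s" "s \<le> t'" for x s t'
    using lift_Suc_mono_le[of L, OF mono that(2)] that(1) by blast
  \<comment> \<open>Without singletons, the only nonempty proper subsets of \<open>K\<close> left
    are the pairs.\<close>
  have pair: "\<exists>j\<in>K. c = K - {j}" if c: "c \<in> L 3" "c \<subseteq> K" "c \<noteq> {}" "c \<noteq> K" for c
  proof -
    obtain i j where ij: "i \<in> c" "j \<in> K" "j \<notin> c" using c by blast
    have "c \<noteq> {i}" using c(1) False ij(1) c(2) by blast
    moreover obtain k l where "K = {j, k, l}"
      using card_3_obtain_others[OF K ij(2)] .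
    ultimately show ?thesis using ij c(2,3) by blast
  qed
  \<comment> \<open>A later label never contains an earlier one that it was joined to. So none is
    \<open>K\<close>, and \<open>c\<close>, \<open>d\<close>, \<open>e\<close> are three distinct
    pairs, hence all of them.\<close>
  obtain c where c: "c \<in> L 1" "c \<subseteq> K" "c \<noteq> {}" "\<not> a \<subseteq> c"
    using join[of 0 a a] ne n by auto
  obtain i where i: "i \<in> K" "c = K - {i}"
    using pair[of c] m[OF c(1)] c ne(2) by auto
  obtain d where d: "d \<in> L 2" "d \<subseteq> K" "d \<noteq> {}" "\<not> c \<subseteq> d"
    using join[of 1 c c] c n by (auto simp: numeral_2_eq_2)
  obtain j where j: "j \<in> K" "d = K - {j}"
    using pair[of d] m[OF d(1)] d c(2) by auto
  obtain e where e: "e \<in> L 3" "e \<subseteq> K" "e \<noteq> {}" "\<not> c \<subseteq> e" "\<not> d \<subseteq> e"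
    using join[of 2 c d] m[OF c(1), of 2] d n by (auto simp: numeral_3_eq_3 numeral_2_eq_2)
  obtain k where k: "k \<in> K" "e = K - {k}"
    using pair[of e] e c(2) by auto
  have "i \<noteq> j" "i \<noteq> k" "j \<noteq> k"
    using d(4) e(4,5) i j k by auto
  then have "{i, j, k} = K"
    using K i(1) j(1) k(1) by (intro card_subset_eq) (auto intro: card_ge_0_finite)
  then show ?thesis
    using m[OF c(1), of 3] m[OF d(1), of 3] e(1) i j k by auto
qed

section \<open>The universal families of bounded trees\<close>

datatype tree = Node (children: "tree list")

text \<open>The index \<open>n\<close> counts levels: \<open>trees k (Suc t)\<close> holds the trees
  of height at most \<open>t\<close>, which explains the shift in \<open>L\<close> below.\<close>

fun trees :: "nat \<Rightarrow> nat \<Rightarrow> tree set" where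
  "trees k 0 = {}"
| "trees k (Suc n) = Node ` {xs. set xs \<subseteq> trees k n \<and> length xs \<le> k}"

lemma finite_trees: "finite (trees k n)"
  by (induction n) (simp_all add: finite_lists_length_le)

lemma trees_mono: "trees k n \<subseteq> trees k (Suc n)"
proof (induction n)
  case (Suc n)
  then show ?case by (simp only: trees.simps) blast
qed simp

lemma Node_Nil_in_trees: "Node [] \<in> trees k (Suc n)"
  by simp

lemma length_children_le:
  assumes "t \<in> trees k n"
  shows "length (children t) \<le> k"
  using assms by (cases n) auto

lemma children_in_trees:
  assumes "t \<in> trees k n" "s \<in> set (children t)"
  shows "s \<in> trees k n"
proof (cases n)
  case (Suc m)
  then have "s \<in> trees k m" using assms by auto
  then show ?thesis using Suc trees_mono by blast
qed (use assms in simp)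

lemma size_child_less:
  assumes "s \<in> set (children t)"
  shows "size s < size t"
proof (cases t)
  case (Node ts)
  then have "size s \<le> size_list size ts"
    using assms by (intro size_list_estimation'[of s]) auto
  then show ?thesis using Node by simp
qed

text \<open>Any \<open>k\<close> trees of one level are the children of some tree of the next, so up
  to \<open>k\<close> attained labels can be avoided at once.\<close>

lemma tree_join:
  assumes C: "\<And>u v. v \<in> T \<Longrightarrow> u \<in> set (children v) \<Longrightarrow> \<not> C u \<subseteq> C v"
    and T: "trees k (Suc (Suc s)) \<subseteq> T"
    and xs: "length xs \<le> k" "set xs \<subseteq> C ` trees k (Suc s)"
  shows "\<exists>c\<in>C ` trees k (Suc (Suc s)). \<forall>a\<in>set xs. \<not> a \<subseteq> c"
proof -
  have "xs \<in> lists (C ` trees k (Suc s))" using xs(2) by auto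
  then obtain ts where ts: "xs = map C ts" "set ts \<subseteq> trees k (Suc s)"
    unfolding lists_image by auto
  then have "Node ts \<in> trees k (Suc (Suc s))"
    using xs(1) by auto
  then show ?thesis
    using C[of "Node ts"] T ts(1) by (intro bexI[of _ "C (Node ts)"]) auto
qed

section \<open>The ternary tree digraph needs more than three cuts\<close>

definition tree_digraph :: "nat \<Rightarrow> nat \<Rightarrow> tree pair_pre_digraph" where
  "tree_digraph k n = \<lparr>pverts = trees k n,
     parcs = {(s, t). t \<in> trees k n \<and> s \<in> set (children t)}\<rparr>"

text \<open>In-neighbours are children, at most \<open>k\<close> of them, and \<open>size\<close>
  grows along arcs.\<close>

lemma tree_digraph_in_class: "tree_digraph k n \<in> acyclic_digraph_class (int k) dp"
proof -
  let ?A = "{(s, t). t \<in> trees k n \<and> s \<in> set (children t)}"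
  have "?A \<subseteq> trees k n \<times> trees k n"
    using children_in_trees by blast
  then have fin: "finite ?A"
    using finite_trees finite_subset by blast
  have "pair_fin_digraph (tree_digraph k n)"
    by unfold_locales
      (auto simp: tree_digraph_def finite_trees fin intro: children_in_trees)
  moreover have "wf ?A"
    by (rule wf_subset[OF wf_measure[of size]]) (auto simp: size_child_less)
  then have "acyclic ?A" by (rule wf_acyclic)
  then have "acyclic (parcs (tree_digraph k n))"
    by (simp add: tree_digraph_def)
  moreover have "in_degree (with_proj (tree_digraph k n)) v \<le> k"
    if "v \<in> pverts (tree_digraph k n)" for v
  proof -
    have v: "v \<in> trees k n" using that by (simp add: tree_digraph_def)
    have "card {u. (u, v) \<in> parcs (tree_digraph k n)} \<le> length (children v)"
      by (rule card_le_length) (auto simp: tree_digraph_def)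
    then show ?thesis
      using length_children_le[OF v] by (simp add: in_degree_eq_card)
  qed
  ultimately show ?thesis
    by (simp add: acyclic_digraph_class_def)
qed

lemma tree_digraph_not_covered: "\<not> covered_by_cuts 3 (tree_digraph 3 10)"
proof
  define K where "K = {1..3::nat}"
  have cK: "card K = 3" by (simp add: K_def)
  have wf: "pair_wf_digraph (tree_digraph 3 10)"
    using tree_digraph_in_class[of 3 10]
    by (auto simp: acyclic_digraph_class_def pair_fin_digraph_def)
  assume "covered_by_cuts 3 (tree_digraph 3 10)"
  then obtain C where CK: "\<And>v. C v \<subseteq> K"
    and C: "\<And>u v. v \<in> trees 3 10 \<Longrightarrow> u \<in> set (children v) \<Longrightarrow> \<not> C u \<subseteq> C v"
    unfolding covered_by_cuts_iff_labeling[OF wf] K_def by (fastforce simp: tree_digraph_def)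
  have sub: "trees 3 m \<subseteq> trees 3 n" if "m \<le> n" for m n
    using lift_Suc_mono_le[of "trees 3", OF trees_mono that] .
  \<comment> \<open>The tenth level exists only to give each tree of the first nine an
    out-neighbour, \<open>Node [v]\<close>.\<close>
  have ne: "C v \<noteq> {}" if "v \<in> trees 3 9" for v
  proof -
    have "Node [v] \<in> trees 3 (Suc 9)" using that by (subst trees.simps) auto
    then show ?thesis using C[of "Node [v]" v] by auto
  qed
  define L where "L t = C ` trees 3 (Suc t)" for t
  have mono: "L t \<subseteq> L (Suc t)" for t
    unfolding L_def by (intro image_mono trees_mono)
  have join: "\<exists>c\<in>L (Suc s). c \<subseteq> K \<and> c \<noteq> {} \<and> (\<forall>a\<in>set xs. \<not> a \<subseteq> c)"
    if s: "s < 8" and xs: "length xs \<le> 3" "set xs \<subseteq> L s" for s xs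
  proof -
    have "trees 3 (Suc (Suc s)) \<subseteq> trees 3 9" "trees 3 (Suc (Suc s)) \<subseteq> trees 3 10"
      using s by (intro sub; simp)+
    note T = this
    obtain t where t: "t \<in> trees 3 (Suc (Suc s))" "\<forall>a\<in>set xs. \<not> a \<subseteq> C t"
      using tree_join[OF C T(2) xs(1) xs(2)[unfolded L_def]] by blast
    then have "C t \<noteq> {}" using T(1) ne by blast
    then show ?thesis using t CK unfolding L_def by blast
  qed
  have join2: "\<exists>c\<in>L (Suc s). c \<subseteq> K \<and> c \<noteq> {} \<and> \<not> a \<subseteq> c \<and> \<not> b \<subseteq> c"
    if "s < 8" "a \<in> L s" "b \<in> L s" for s a b
    using join[of s "[a, b]"] that by auto
  have join3: "\<exists>c\<in>L (Suc s). c \<subseteq> K \<and> c \<noteq> {} \<and> \<not> f 1 \<subseteq> c \<and> \<not> f 2 \<subseteq> c \<and> \<not> f 3 \<subseteq> c"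
    if "s < 8" "\<forall>j\<in>K. f j \<in> L s" for s and f :: "nat \<Rightarrow> nat set"
    using join[of s "[f 1, f 2, f 3]"] that by (auto simp: K_def)
  have K3: "K = {1, 2, 3}" by (auto simp: K_def)
  \<comment> \<open>A singleton in \<open>L 4\<close> yields all three in \<open>L 7\<close>; a node
    joining them would have an empty label, yet labels in \<open>L 8\<close> are nonempty.\<close>
  have no_single: "{i} \<notin> L 4" if "i \<in> K" for i
  proof
    assume "{i} \<in> L 4"
    then have "\<forall>j\<in>K. {j} \<in> L 7"
      using singletons_attained[where L = L, OF cK mono join2 that, where t = 4] by simp
    then show False
      using join3[of 7 "\<lambda>j. {j}"] K3 by auto
  qed
  have "C (Node []) \<in> L 0" by (simp add: L_def)
  then have "(\<forall>j\<in>K. {j} \<in> L 6) \<or> (\<forall>j\<in>K. K - {j} \<in> L 3)"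
    using singletons_or_pairs_attained[where L = L and n = 8, OF cK mono join2 _ CK] by simp
  then show False
  proof (elim disjE)
    assume "\<forall>j\<in>K. {j} \<in> L 6"
    then have "\<forall>j\<in>K. {j} \<in> L 7" using mono[of 6] by auto
    then show False
      using join3[of 7 "\<lambda>j. {j}"] K3 by auto
  next
    assume "\<forall>j\<in>K. K - {j} \<in> L 3"
    then obtain c where c: "c \<in> L 4" "c \<subseteq> K" "c \<noteq> {}"
      "\<not> K - {1} \<subseteq> c" "\<not> K - {2} \<subseteq> c" "\<not> K - {3} \<subseteq> c"
      using join3[of 3 "\<lambda>j. K - {j}"] by auto
    have "\<not> K - {j} \<subseteq> c" if "j \<in> K" for j
    proof -
      have "j = 1 \<or> j = 2 \<or> j = 3" using that K3 by simp
      then show ?thesis using c(4-6) by (elim disjE) simp_all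
    qed
    then have "\<exists>i\<in>K. c = {i}"
      using singleton_if_no_pair[OF cK c(2,3)] by blast
    then show False using c(1) no_single by auto
  qed
qed

section \<open>A digraph for \<open>c(2,2) > 3\<close>\<close>

text \<open>The vertex \<open>W\<close> of the construction is \<open>High (Node [])\<close>.\<close>

datatype vertex = Low tree | U | V | High tree | Z | Sink

inductive_set arcs22 :: "(vertex \<times> vertex) set" where
  "t \<in> trees 2 7 \<Longrightarrow> s \<in> set (children t) \<Longrightarrow> (Low s, Low t) \<in> arcs22"
| "t \<in> trees 2 7 \<Longrightarrow> (Low t, U) \<in> arcs22"
| "(U, V) \<in> arcs22"
| "(U, High (Node [])) \<in> arcs22"
| "(V, High (Node [])) \<in> arcs22"
| "t \<in> trees 2 7 \<Longrightarrow> s \<in> set (children t) \<Longrightarrow> (High s, High t) \<in> arcs22"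
| "t \<in> trees 2 7 \<Longrightarrow> (High t, Z) \<in> arcs22"
| "(Z, Sink) \<in> arcs22"

definition verts22 :: "vertex set" where
  "verts22 = Low ` trees 2 7 \<union> High ` trees 2 7 \<union> {U, V, Z, Sink}"

definition digraph22 :: "vertex pair_pre_digraph" where
  "digraph22 = \<lparr>pverts = verts22, parcs = arcs22\<rparr>"

text \<open>With \<open>depth\<close> as tie-breaker inside each tree copy, this rank strictly
  increases along arcs and so proves acyclicity.\<close>

fun layer :: "vertex \<Rightarrow> nat" where
  "layer (Low _) = 0"
| "layer U = 1"
| "layer V = 2"
| "layer (High _) = 3"
| "layer Z = 4"
| "layer Sink = 5"

fun depth :: "vertex \<Rightarrow> nat" where
  "depth (Low t) = size t"
| "depth (High t) = size t"
| "depth _ = 0"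

lemma arcs22_subset: "arcs22 \<subseteq> verts22 \<times> verts22"
proof -
  have N: "Node [] \<in> trees 2 7" using Node_Nil_in_trees[of 2 6] by simp
  have "u \<in> verts22 \<and> v \<in> verts22" if "(u, v) \<in> arcs22" for u v
    using that
  proof cases
    case (1 t s)
    then show ?thesis using children_in_trees[of t 2 7 s] by (simp add: verts22_def)
  next
    case (6 t s)
    then show ?thesis using children_in_trees[of t 2 7 s] by (simp add: verts22_def)
  qed (use N in \<open>simp_all add: verts22_def\<close>)
  then show ?thesis by auto
qed

text \<open>Tree vertices have indegree at most 2: the childless \<open>High (Node [])\<close> has
  room for \<open>U\<close> and \<open>V\<close>. The other vertices have outdegree at most
  2.\<close>

lemma digraph22_in_class: "digraph22 \<in> acyclic_digraph_class 2 2"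
proof -
  have finv: "finite verts22" by (simp add: verts22_def finite_trees)
  then have fin: "finite arcs22"
    using arcs22_subset finite_subset by blast
  have "pair_fin_digraph digraph22"
    by unfold_locales (use arcs22_subset finv fin in \<open>auto simp: digraph22_def\<close>)
  moreover have "wf arcs22"
    by (rule wf_subset[OF wf_measures[of "[layer, depth]"]])
      (auto elim: arcs22.cases simp: size_child_less)
  then have "acyclic arcs22" by (rule wf_acyclic)
  moreover have "card {u. (u, v) \<in> arcs22} \<le> 2 \<or> card {w. (v, w) \<in> arcs22} \<le> 2"
    if v: "v \<in> verts22" for v
  proof -
    have ins: ?thesis if "\<And>u. (u, v) \<in> arcs22 \<Longrightarrow> u \<in> set xs" "length xs \<le> 2" for xs
      using card_le_length[of "{u. (u, v) \<in> arcs22}" xs] that by fastforce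
    have outs: ?thesis if "\<And>w. (v, w) \<in> arcs22 \<Longrightarrow> w \<in> set xs" "length xs \<le> 2" for xs
      using card_le_length[of "{w. (v, w) \<in> arcs22}" xs] that by fastforce
    show ?thesis
    proof (cases v)
      case (Low t)
      then have "t \<in> trees 2 7" using v by (auto simp: verts22_def)
      then show ?thesis
        using length_children_le Low
        by (intro ins[of "map Low (children t)"]) (auto elim: arcs22.cases)
    next
      case (High t)
      then have "t \<in> trees 2 7" using v by (auto simp: verts22_def)
      then show ?thesis
        using length_children_le High
        by (intro ins[of "if t = Node [] then [U, V] else map High (children t)"])
          (auto elim: arcs22.cases)
    next
      case U
      then show ?thesis
        by (intro outs[of "[V, High (Node [])]"]) (auto elim: arcs22.cases)
    next
      case V
      then show ?thesis
        by (intro outs[of "[High (Node [])]"]) (auto elim: arcs22.cases)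
    next
      case Z
      then show ?thesis
        by (intro outs[of "[Sink]"]) (auto elim: arcs22.cases)
    next
      case Sink
      then show ?thesis
        by (intro outs[of "[]"]) (auto elim: arcs22.cases)
    qed
  qed
  ultimately show ?thesis
    by (auto simp: acyclic_digraph_class_def digraph22_def in_degree_eq_card out_degree_eq_card)
qed

lemma digraph22_not_covered: "\<not> covered_by_cuts 3 digraph22"
proof
  define K where "K = {1..3::nat}"
  have cK: "card K = 3" by (simp add: K_def)
  have wf: "pair_wf_digraph digraph22"
    using digraph22_in_class by (auto simp: acyclic_digraph_class_def pair_fin_digraph_def)
  assume "covered_by_cuts 3 digraph22"
  then have "\<exists>C. (\<forall>v. C v \<subseteq> K) \<and> (\<forall>u v. (u, v) \<in> arcs22 \<longrightarrow> \<not> C u \<subseteq> C v)"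
    unfolding covered_by_cuts_iff_labeling[OF wf] K_def by (simp add: digraph22_def)
  then obtain C where CK: "\<And>v. C v \<subseteq> K"
    and C: "\<And>u v. (u, v) \<in> arcs22 \<Longrightarrow> \<not> C u \<subseteq> C v"
    by blast
  have sub: "trees 2 m \<subseteq> trees 2 n" if "m \<le> n" for m n
    using lift_Suc_mono_le[of "trees 2", OF trees_mono that] .
  define L where "L F t = (\<lambda>x. C (F x)) ` trees 2 (Suc t)" for F :: "tree \<Rightarrow> vertex" and t
  have mono: "L F t \<subseteq> L F (Suc t)" for F t
    unfolding L_def by (intro image_mono trees_mono)
  \<comment> \<open>\<open>F\<close> is one of the two tree copies and \<open>w\<close> the vertex
    collecting it, \<open>U\<close> or \<open>Z\<close>; the arcs to \<open>w\<close> keep the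
    labels nonempty.\<close>
  have join: "\<exists>c\<in>L F (Suc s). c \<subseteq> K \<and> c \<noteq> {} \<and> \<not> a \<subseteq> c \<and> \<not> b \<subseteq> c"
    if F: "\<And>u v. v \<in> trees 2 7 \<Longrightarrow> u \<in> set (children v) \<Longrightarrow> (F u, F v) \<in> arcs22"
      "\<And>v. v \<in> trees 2 7 \<Longrightarrow> (F v, w) \<in> arcs22"
      and s: "s < 6" and ab: "a \<in> L F s" "b \<in> L F s" for F w s a b
  proof -
    have T: "trees 2 (Suc (Suc s)) \<subseteq> trees 2 7"
      using s by (intro sub) simp
    have "\<exists>c\<in>L F (Suc s). \<forall>a\<in>set [a, b]. \<not> a \<subseteq> c"
      unfolding L_def
      by (rule tree_join[OF _ T, of "\<lambda>x. C (F x)"]) (use F(1) C ab in \<open>auto simp: L_def\<close>)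
    then obtain c where c: "c \<in> L F (Suc s)" "\<not> a \<subseteq> c" "\<not> b \<subseteq> c" by auto
    then obtain x where x: "x \<in> trees 2 (Suc (Suc s))" "c = C (F x)"
      unfolding L_def by blast
    have "\<not> c \<subseteq> C w" using x T C F(2) by blast
    then have "c \<noteq> {}" by blast
    then show ?thesis using c x CK by blast
  qed
  have join_Low: "\<exists>c\<in>L Low (Suc s). c \<subseteq> K \<and> c \<noteq> {} \<and> \<not> a \<subseteq> c \<and> \<not> b \<subseteq> c"
    if "s < 6" "a \<in> L Low s" "b \<in> L Low s" for s a b
    by (rule join[OF arcs22.intros(1,2) that])
  have join_High: "\<exists>c\<in>L High (Suc s). c \<subseteq> K \<and> c \<noteq> {} \<and> \<not> a \<subseteq> c \<and> \<not> b \<subseteq> c"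
    if "s < 6" "a \<in> L High s" "b \<in> L High s" for s a b
    by (rule join[OF arcs22.intros(6,7) that])
  \<comment> \<open>The arc from \<open>w\<close> to \<open>w'\<close> makes \<open>C w\<close>
    nonempty, and no in-neighbour of \<open>w\<close> may carry \<open>{j}\<close> with
    \<open>j\<close> in \<open>C w\<close>.\<close>
  have not_all: "\<exists>j\<in>K. {j} \<notin> L F s"
    if F: "\<And>v. v \<in> trees 2 7 \<Longrightarrow> (F v, w) \<in> arcs22" "(w, w') \<in> arcs22" "s \<le> 6" for F w w' s
  proof -
    obtain j where j: "j \<in> C w" using C[OF F(2)] by blast
    have "{j} \<notin> L F s"
      using C[OF F(1)] sub[of "Suc s" 7] F(3) j unfolding L_def by fastforce
    then show ?thesis using j CK by blast
  qed
  have "C (Low (Node [])) \<in> L Low 0" by (simp add: L_def)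
  then have "(\<forall>j\<in>K. {j} \<in> L Low 6) \<or> (\<forall>j\<in>K. K - {j} \<in> L Low 3)"
    using singletons_or_pairs_attained[where L = "L Low" and n = 6, OF cK mono join_Low _ CK]
    by simp
  then have pairs: "\<forall>j\<in>K. K - {j} \<in> L Low 3"
    using not_all[where F = Low and s = 6, OF arcs22.intros(2,3)] by auto
  have nU: "\<not> K - {j} \<subseteq> C U" if "j \<in> K" for j
  proof -
    have "K - {j} \<in> L Low 3" using pairs that by blast
    then obtain x where x: "x \<in> trees 2 (Suc 3)" "K - {j} = C (Low x)"
      unfolding L_def by blast
    moreover have "trees 2 (Suc 3) \<subseteq> trees 2 7" by (intro sub) simp
    ultimately have "x \<in> trees 2 7" by blast
    from C[OF arcs22.intros(2)[OF this]] show ?thesis using x(2) by simp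
  qed
  have "C U \<noteq> {}" using C[OF arcs22.intros(3)] by auto
  then obtain i where i: "i \<in> K" "C U = {i}"
    using singleton_if_no_pair[OF cK CK _ nU] by auto
  define W where "W = High (Node [])"
  have W7: "Node [] \<in> trees 2 7" using Node_Nil_in_trees[of 2 6] by simp
  have W: "i \<notin> C V" "i \<notin> C W" "\<not> C V \<subseteq> C W" "C W \<noteq> {}"
    using C[OF arcs22.intros(3)] C[OF arcs22.intros(4)] C[OF arcs22.intros(5)]
      C[OF arcs22.intros(7)[OF W7]] i(2) unfolding W_def by auto
  obtain j k where jk: "K = {i, j, k}"
    using card_3_obtain_others[OF cK i(1)] .
  have "C V \<subseteq> {j, k}" "C W \<subseteq> {j, k}"
    using CK[of V] CK[of W] W(1,2) jk by auto
  moreover from this(1) have "\<not> {j, k} \<subseteq> C W" using W(3) by auto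
  ultimately have "C W = {j} \<or> C W = {k}" using W(4) by auto
  then have "\<exists>j\<in>K. C W = {j}" using jk by auto
  \<comment> \<open>\<open>W\<close> is a leaf of the upper copy, so its singleton is available at
    height 0.\<close>
  moreover have "C W \<in> L High 0" by (simp add: L_def W_def)
  ultimately obtain j where j: "j \<in> K" "{j} \<in> L High 0" by auto
  have "\<forall>k\<in>K. {k} \<in> L High 3"
    using singletons_attained[where L = "L High" and n = 6, OF cK mono join_High j] by simp
  then show False
    using not_all[where F = High and s = 3, OF arcs22.intros(7,8)] by auto
qed

theorem theorem2p3:
  shows "cut_number 2 1 \<le> 3 \<and> cut_number 3 (-1) > 3 \<and> cut_number 2 2 > 3"
proof (intro conjI)
  show "cut_number 2 1 \<le> 3"
    using cut_number_le[OF covered_by_three_cuts] by (simp add: numeral_eq_enat)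
  show "cut_number 3 (-1) > 3"
    using cut_number_greater[OF tree_digraph_in_class tree_digraph_not_covered, of "-1"]
    by (simp add: numeral_eq_enat)
  show "cut_number 2 2 > 3"
    using cut_number_greater[OF digraph22_in_class digraph22_not_covered]
    by (simp add: numeral_eq_enat)
qed

end
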